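(* For every $k\in\mathbb{N}$ there are positive constants $\gamma_k>0$, $\mu_k>0$ and a threshold $n_0(k)$ such that the following holds. Let $A$ and $C$ be $n$-element pointsets in the plane that are mutually avoiding, and let $B$ be an $n$-element pointset such that no line determined by two points of $A$, and no line determined by two points of $C$, intersects the convex hull of $B$. Suppose there are at least $\mu_k n^{2-\gamma_k}$ collinear triples $(a,b,c)$ with $a\in A$, $b\in B$, $c\in C$. If $n\ge n_0(k)$, then there is a $k$-system among these collinear triples.
   Context: Two finite pointsets $A$ and $C$ in the plane are mutually avoiding if no line determined by two points of one set intersects the convex hull of the other. A collinear triple $(a,b,c)$ has $a\in A,b\in B,c\in C$ lying on a common line. A $k$-system ($k$-complete collinear triple arrangement) consists of $k$ pairwise disjoint $k$-element sets $A_1,\dots,A_k\subseteq A$, with $A_i=\{a^{(i)}_1,\dots,a^{(i)}_k\}$, and $k$ pairwise disjoint $k$-element sets $C_1,\dots,C_k\subseteq C$, with $C_j=\{c^{(j)}_1,\dots,c^{(j)}_k\}$, such that for every $1\le i,j\le k$ there is a point $b_{i,j}\in B$ with the property that for every $1\le \ell\le k$ the points $a^{(i)}_\ell$, $b_{i,j}$, $c^{(j)}_{k-\ell+1}$ form a collinear triple. *)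

theory Defs
  imports "HOL-Analysis.Analysis"
begin

definition line_avoiding :: "(real^2) set \<Rightarrow> (real^2) set \<Rightarrow> bool" where
  "line_avoiding X Y \<longleftrightarrow>
     (\<forall>p\<in>X. \<forall>q\<in>X. p \<noteq> q \<longrightarrow> affine hull {p, q} \<inter> convex hull Y = {})"

definition mutually_avoiding :: "(real^2) set \<Rightarrow> (real^2) set \<Rightarrow> bool" where
  "mutually_avoiding X Y \<longleftrightarrow> line_avoiding X Y \<and> line_avoiding Y X"

definition collinear_triples ::
  "(real^2) set \<Rightarrow> (real^2) set \<Rightarrow> (real^2) set \<Rightarrow> ((real^2) \<times> (real^2) \<times> (real^2)) set" where
  "collinear_triples A B C = {(a, b, c). a \<in> A \<and> b \<in> B \<and> c \<in> C \<and> collinear {a, b, c}}"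

text \<open>
  A \<open>k\<close>-system is given by enumerations \<open>a i\<close> of \<open>A\<^sub>i\<close> and \<open>c j\<close> of \<open>C\<^sub>j\<close> by the indices
  \<open>1, \<dots>, k\<close>; the enumerations are arbitrary, and the points \<open>b i j\<close> need not be distinct.
\<close>

definition has_k_system ::
  "nat \<Rightarrow> (real^2) set \<Rightarrow> (real^2) set \<Rightarrow> (real^2) set \<Rightarrow> bool" where
  "has_k_system k A B C \<longleftrightarrow>
     (\<exists>(a :: nat \<Rightarrow> nat \<Rightarrow> real^2) (b :: nat \<Rightarrow> nat \<Rightarrow> real^2) (c :: nat \<Rightarrow> nat \<Rightarrow> real^2).
        (\<forall>i\<in>{1..k}. a i ` {1..k} \<subseteq> A \<and> card (a i ` {1..k}) = k) \<and>
        disjoint_family_on (\<lambda>i. a i ` {1..k}) {1..k} \<and>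
        (\<forall>j\<in>{1..k}. c j ` {1..k} \<subseteq> C \<and> card (c j ` {1..k}) = k) \<and>
        disjoint_family_on (\<lambda>j. c j ` {1..k}) {1..k} \<and>
        (\<forall>i\<in>{1..k}. \<forall>j\<in>{1..k}. b i j \<in> B \<and>
           (\<forall>l\<in>{1..k}. (a i l, b i j, c j (k - l + 1)) \<in> collinear_triples A B C)))"

end

theory Submission
  imports Defs
begin

text \<open>
  Order \<open>A\<close> as seen from \<open>C\<close> and \<open>C\<close> as seen from \<open>A\<close>. Projecting through a point \<open>b \<in> B\<close> gives a
  partial matching between \<open>A\<close> and \<open>C\<close> that is monotone, and two pairs of a matching determine \<open>b\<close>.
  Cut both orders into blocks of length \<open>t \<approx> n powr \<gamma>\<close>. A monotone matching meets only \<open>O(n / t)\<close>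
  pairs of blocks, so the many triples force about \<open>(n / t)\<^sup>2\<close> choices of \<open>b\<close> and a pair of blocks
  with at least \<open>K\<close> matched pairs. By pigeonhole, a proportion \<open>1 / t ^ (2 * K)\<close> of them have their
  \<open>K\<close> pairs at the same positions inside the blocks. As \<open>b\<close> is determined by such pairs, the
  blocks span a bipartite graph with \<open>n powr (2 - O(\<gamma>))\<close> edges, and a \<open>K\<close> by \<open>K\<close> complete bipartite
  subgraph is a \<open>K\<close>-system.
\<close>

subsection \<open>Monotone matchings and complete bipartite subgraphs\<close>

text \<open>Double counting of pairs of a left vertex of degree at least \<open>D\<close> and a
  \<open>K\<close>-subset \<open>T\<close> of its neighbourhood. The other left vertices carry at
  most \<open>D * m\<close> edges, so at least \<open>D\<close> vertices have large degree; as there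
  are at most \<open>m ^ K\<close> sets \<open>T\<close>, one of them lies in at least
  \<open>K\<close> neighbourhoods.\<close>

lemma kovari_sos_turan:
  fixes E :: "('a \<times> 'b) set"
  assumes X: "finite X" "card X \<le> m" and Y: "finite Y" "card Y \<le> m" and E: "E \<subseteq> X \<times> Y"
    and m: "0 < m" and edges: "2 * D * m \<le> card E"
    and dense: "K * m ^ K < D * (D choose K)"
  obtains S T where "S \<subseteq> X" "T \<subseteq> Y" "card S = K" "card T = K" "S \<times> T \<subseteq> E"
proof -
  define N where "N x = {y \<in> Y. (x, y) \<in> E}" for x
  have finN: "finite (N x)" for x using Y by (simp add: N_def)
  define X' where "X' = {x \<in> X. D \<le> card (N x)}"
  define TT where "TT = {T. T \<subseteq> Y \<and> card T = K}"
  have finX': "finite X'" using X by (simp add: X'_def)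
  have finTT: "finite TT" using Y by (simp add: TT_def)
  have "E = Sigma X N" using E by (auto simp: N_def)
  hence "card E = (\<Sum>x\<in>X. card (N x))"
    using X finN by simp
  also have "\<dots> \<le> (\<Sum>x\<in>X. (if x \<in> X' then m else 0) + D)"
  proof (rule sum_mono)
    fix x assume "x \<in> X"
    have "card (N x) \<le> card Y" using Y by (intro card_mono) (auto simp: N_def)
    thus "card (N x) \<le> (if x \<in> X' then m else 0) + D"
      using Y \<open>x \<in> X\<close> by (auto simp: X'_def)
  qed
  also have "\<dots> = card X' * m + card X * D"
  proof -
    have "X \<inter> X' = X'" by (auto simp: X'_def)
    thus ?thesis using X by (simp add: sum.distrib sum.If_cases)
  qed
  also have "\<dots> \<le> card X' * m + m * D" using X by simp
  finally have "2 * D * m \<le> card X' * m + m * D" using edges by linarith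
  moreover have "2 * D * m = D * m + m * D" by (simp add: algebra_simps)
  ultimately have "D * m \<le> card X' * m" by linarith
  hence DX': "D \<le> card X'" using m by simp
  have "K * m ^ K < D * (D choose K)" by (rule dense)
  also have "\<dots> \<le> card X' * (D choose K)" using DX' by simp
  also have "\<dots> = (\<Sum>x\<in>X'. D choose K)" by simp
  also have "\<dots> \<le> (\<Sum>x\<in>X'. card {T \<in> TT. T \<subseteq> N x})"
  proof (rule sum_mono)
    fix x assume x: "x \<in> X'"
    have "{T \<in> TT. T \<subseteq> N x} = {T. T \<subseteq> N x \<and> card T = K}"
      by (auto simp: TT_def N_def)
    hence "card {T \<in> TT. T \<subseteq> N x} = card (N x) choose K"
      using n_subsets[OF finN] by simp
    thus "D choose K \<le> card {T \<in> TT. T \<subseteq> N x}"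
      using x by (simp add: X'_def binomial_right_mono)
  qed
  also have "\<dots> = (\<Sum>T\<in>TT. card {x \<in> X'. T \<subseteq> N x})"
    using sum.swap_restrict[OF finX' finTT, of "\<lambda>_ _. 1::nat" "\<lambda>x T. T \<subseteq> N x"] by simp
  finally have gt: "K * m ^ K < (\<Sum>T\<in>TT. card {x \<in> X'. T \<subseteq> N x})" .
  have "card TT = card Y choose K" unfolding TT_def by (rule n_subsets) (use Y in auto)
  also have "\<dots> \<le> m choose K" using Y by (simp add: binomial_right_mono)
  also have "\<dots> \<le> m ^ K"
    by (cases "K \<le> m") (simp_all add: binomial_le_pow binomial_eq_0)
  finally have TTle: "card TT \<le> m ^ K" .
  have "\<exists>T\<in>TT. K \<le> card {x \<in> X'. T \<subseteq> N x}"
  proof (rule ccontr)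
    assume "\<not> ?thesis"
    hence "(\<Sum>T\<in>TT. card {x \<in> X'. T \<subseteq> N x}) \<le> (\<Sum>T\<in>TT. K)"
      by (intro sum_mono) (meson nat_le_linear)
    also have "\<dots> \<le> K * m ^ K" using TTle by simp
    finally show False using gt by simp
  qed
  then obtain T where T: "T \<in> TT" "K \<le> card {x \<in> X'. T \<subseteq> N x}" by blast
  then obtain S where S: "S \<subseteq> {x \<in> X'. T \<subseteq> N x}" "card S = K"
    by (meson obtain_subset_with_card_n)
  show ?thesis
    by (rule that[of S T]) (use S T in \<open>auto simp: X'_def TT_def N_def\<close>)
qed

section \<open>Monotone matchings in a grid of cells\<close>

definition iso_matching :: "(nat \<times> nat) set \<Rightarrow> bool" where
  "iso_matching M \<longleftrightarrow> (\<forall>p\<in>M. \<forall>q\<in>M. fst p < fst q \<longleftrightarrow> snd p < snd q)"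

definition anti_matching :: "(nat \<times> nat) set \<Rightarrow> bool" where
  "anti_matching M \<longleftrightarrow> (\<forall>p\<in>M. \<forall>q\<in>M. fst p < fst q \<longleftrightarrow> snd q < snd p)"

definition monotone_matching :: "(nat \<times> nat) set \<Rightarrow> bool" where
  "monotone_matching M \<longleftrightarrow> iso_matching M \<or> anti_matching M"

text \<open>The defining equivalence applies to \<open>(p, q)\<close> and to \<open>(q, p)\<close>,
  so both strict inequalities fail for the first coordinates exactly when both fail for the
  second.\<close>

lemma monotone_matching_fst_eq_iff:
  assumes "monotone_matching M" "p \<in> M" "q \<in> M"
  shows "fst p = fst q \<longleftrightarrow> snd p = snd q"
proof -
  have "(fst p < fst q \<longleftrightarrow> snd p < snd q) \<and> (fst q < fst p \<longleftrightarrow> snd q < snd p) \<or>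
      (fst p < fst q \<longleftrightarrow> snd q < snd p) \<and> (fst q < fst p \<longleftrightarrow> snd p < snd q)"
    using assms by (simp add: monotone_matching_def iso_matching_def anti_matching_def) blast
  thus ?thesis by linarith
qed

definition cell :: "nat \<Rightarrow> nat \<times> nat \<Rightarrow> nat \<times> nat" where
  "cell t p = (fst p div t, snd p div t)"

text \<open>The cells met by a monotone matching form a chain, on which \<open>i + j\<close> or \<open>i - j\<close> is injective.\<close>

lemma card_boxes_le:
  assumes M: "monotone_matching M" and box: "cell t ` M \<subseteq> {..<m} \<times> {..<m}"
  shows "card (cell t ` M) \<le> 2 * m"
proof -
  have le_div: "x div t \<le> y div t" if "x \<le> y" for x y using that by (rule div_le_mono)
  consider "iso_matching M" | "anti_matching M" using M by (auto simp: monotone_matching_def)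
  thus ?thesis
  proof cases
    case 1
    have "inj_on (\<lambda>u. fst u + snd u) (cell t ` M)"
    proof (rule inj_onI)
      fix u v assume "u \<in> cell t ` M" "v \<in> cell t ` M" and eq: "fst u + snd u = fst v + snd v"
      then obtain p q where pq: "p \<in> M" "u = cell t p" "q \<in> M" "v = cell t q" by blast
      hence "fst p < fst q \<longleftrightarrow> snd p < snd q" "fst q < fst p \<longleftrightarrow> snd q < snd p"
        using 1 by (simp_all add: iso_matching_def)
      hence "fst p \<le> fst q \<and> snd p \<le> snd q \<or> fst q \<le> fst p \<and> snd q \<le> snd p" by linarith
      thus "u = v"
        using eq pq le_div[of "fst p" "fst q"] le_div[of "snd p" "snd q"]
          le_div[of "fst q" "fst p"] le_div[of "snd q" "snd p"]
        by (auto simp: cell_def)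
    qed
    moreover have "(\<lambda>u. fst u + snd u) ` (cell t ` M) \<subseteq> {..<2 * m}"
    proof
      fix v assume "v \<in> (\<lambda>u. fst u + snd u) ` (cell t ` M)"
      then obtain u where "u \<in> cell t ` M" "v = fst u + snd u" by blast
      thus "v \<in> {..<2 * m}" using box by fastforce
    qed
    ultimately show ?thesis
      using card_inj_on_le[of "\<lambda>u. fst u + snd u" "cell t ` M" "{..<2 * m}"] by simp
  next
    case 2
    have sm: "snd u < m" "fst u < m" if "u \<in> cell t ` M" for u using that box by fastforce+
    \<comment> \<open>This is \<open>fst u - snd u\<close> shifted by \<open>m\<close> to stay in
      the natural numbers; as \<open>snd u < m\<close>, nothing is truncated.\<close>
    have "inj_on (\<lambda>u. fst u + (m - snd u)) (cell t ` M)"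
    proof (rule inj_onI)
      fix u v assume uv: "u \<in> cell t ` M" "v \<in> cell t ` M"
        and eq: "fst u + (m - snd u) = fst v + (m - snd v)"
      then obtain p q where pq: "p \<in> M" "u = cell t p" "q \<in> M" "v = cell t q" by blast
      hence "fst p < fst q \<longleftrightarrow> snd q < snd p" "fst q < fst p \<longleftrightarrow> snd p < snd q"
        using 2 by (simp_all add: anti_matching_def)
      hence "fst p \<le> fst q \<and> snd q \<le> snd p \<or> fst q \<le> fst p \<and> snd p \<le> snd q" by linarith
      thus "u = v"
        using eq pq sm(1)[OF uv(1)] sm(1)[OF uv(2)] le_div[of "fst p" "fst q"]
          le_div[of "snd p" "snd q"] le_div[of "fst q" "fst p"] le_div[of "snd q" "snd p"]
        by (auto simp: cell_def)
    qed
    moreover have "(\<lambda>u. fst u + (m - snd u)) ` (cell t ` M) \<subseteq> {..<2 * m}"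
    proof
      fix v assume "v \<in> (\<lambda>u. fst u + (m - snd u)) ` (cell t ` M)"
      then obtain u where "u \<in> cell t ` M" "v = fst u + (m - snd u)" by blast
      thus "v \<in> {..<2 * m}" using sm[of u] by simp
    qed
    ultimately show ?thesis
      using card_inj_on_le[of "\<lambda>u. fst u + (m - snd u)" "cell t ` M" "{..<2 * m}"] by simp
  qed
qed

text \<open>Distinct pairs of a matching differ in their first coordinates, which here lie in an
  interval of length \<open>t\<close>.\<close>

lemma card_matching_in_box_le:
  assumes M: "monotone_matching M" and t: "0 < t"
  shows "finite {p \<in> M. cell t p = u}" "card {p \<in> M. cell t p = u} \<le> t"
proof -
  have inj: "inj_on fst {p \<in> M. cell t p = u}"
    by (rule inj_onI) (use monotone_matching_fst_eq_iff[OF M] in \<open>auto simp: prod_eq_iff\<close>)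
  have sub: "fst ` {p \<in> M. cell t p = u} \<subseteq> {fst u * t..<fst u * t + t}"
  proof (rule image_subsetI)
    fix p assume "p \<in> {p \<in> M. cell t p = u}"
    hence "fst u * t + fst p mod t = fst p" by (auto simp: cell_def)
    moreover have "fst p mod t < t" using t by simp
    ultimately show "fst p \<in> {fst u * t..<fst u * t + t}" unfolding atLeastLessThan_iff by linarith
  qed
  show "finite {p \<in> M. cell t p = u}"
    using inj sub by (meson finite_atLeastLessThan inj_on_finite)
  show "card {p \<in> M. cell t p = u} \<le> t"
    using card_inj_on_le[OF inj sub] by simp
qed

text \<open>At most \<open>2 * m\<close> cells are met. Each is charged \<open>K\<close>, and each
  rich one \<open>t\<close> more.\<close>

lemma card_matching_le:
  assumes M: "monotone_matching M" and t: "0 < t" and box: "cell t ` M \<subseteq> {..<m} \<times> {..<m}"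
  shows "card M \<le> 2 * m * K + t * card {u \<in> {..<m} \<times> {..<m}. K \<le> card {p \<in> M. cell t p = u}}"
proof -
  let ?H = "cell t ` M"
  let ?R = "{u \<in> {..<m} \<times> {..<m}. K \<le> card {p \<in> M. cell t p = u}}"
  have fin: "finite ?H" using box by (rule finite_subset) simp
  have "M = (\<Union>u\<in>?H. {p \<in> M. cell t p = u})" by auto
  hence "card M \<le> (\<Sum>u\<in>?H. card {p \<in> M. cell t p = u})"
    using card_UN_le[OF fin, of "\<lambda>u. {p \<in> M. cell t p = u}"] by simp
  also have "\<dots> \<le> (\<Sum>u\<in>?H. K + (if u \<in> ?R then t else 0))"
  proof (rule sum_mono)
    fix u assume u: "u \<in> ?H"
    show "card {p \<in> M. cell t p = u} \<le> K + (if u \<in> ?R then t else 0)"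
      using card_matching_in_box_le[OF M t, of u] u box by auto
  qed
  also have "\<dots> = card ?H * K + t * card (?H \<inter> ?R)"
    using fin by (simp add: sum.distrib sum.If_cases)
  also have "\<dots> \<le> 2 * m * K + t * card ?R"
    by (intro add_mono mult_mono card_boxes_le[OF M box] card_mono) auto
  finally show ?thesis .
qed

text \<open>\<open>\<sigma>\<close> and \<open>\<tau>\<close> record the offsets of \<open>K\<close>
  chosen pairs inside the cell \<open>u\<close>. As extensional functions they range over
  \<open>t ^ (2 * K)\<close> possibilities that do not depend on \<open>u\<close>, ready for a
  pigeonhole argument.\<close>

lemma rich_box_type:
  assumes M: "monotone_matching M" and t: "0 < t" and K: "K \<le> card {p \<in> M. cell t p = u}"
  obtains \<sigma> \<tau> where "\<sigma> \<in> {..<K} \<rightarrow>\<^sub>E {..<t}" "\<tau> \<in> {..<K} \<rightarrow>\<^sub>E {..<t}"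
    "inj_on \<sigma> {..<K}" "inj_on \<tau> {..<K}"
    "\<And>l. l < K \<Longrightarrow> (fst u * t + \<sigma> l, snd u * t + \<tau> l) \<in> M"
proof -
  let ?S = "{p \<in> M. cell t p = u}"
  have "finite ?S" by (rule card_matching_in_box_le[OF M t])
  with K have "\<exists>g. inj_on g {..<K} \<and> g ` {..<K} \<subseteq> ?S"
    using card_le_inj[of "{..<K}" ?S] by auto
  then obtain g where g: "inj_on g {..<K}" "g ` {..<K} \<subseteq> ?S" by blast
  have gM: "g l \<in> M" "fst (g l) = fst u * t + fst (g l) mod t"
      "snd (g l) = snd u * t + snd (g l) mod t" if "l < K" for l
  proof -
    have "g l \<in> ?S" using g that by auto
    thus "g l \<in> M" "fst (g l) = fst u * t + fst (g l) mod t"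
      "snd (g l) = snd u * t + snd (g l) mod t" by (auto simp: cell_def)
  qed
  have inj: "l = l'" if "l < K" "l' < K" "fst (g l) = fst (g l') \<or> snd (g l) = snd (g l')" for l l'
  proof -
    have "g l = g l'"
      using that monotone_matching_fst_eq_iff[OF M gM(1)[of l] gM(1)[of l']] by (auto simp: prod_eq_iff)
    thus ?thesis using g(1) that by (simp add: inj_on_eq_iff)
  qed
  show ?thesis
  proof (rule that[of "\<lambda>l\<in>{..<K}. fst (g l) mod t" "\<lambda>l\<in>{..<K}. snd (g l) mod t"])
    show "inj_on (\<lambda>l\<in>{..<K}. fst (g l) mod t) {..<K}"
    proof (rule inj_onI)
      fix l l' assume l: "l \<in> {..<K}" "l' \<in> {..<K}"
        and "(\<lambda>l\<in>{..<K}. fst (g l) mod t) l = (\<lambda>l\<in>{..<K}. fst (g l) mod t) l'"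
      hence "fst (g l) mod t = fst (g l') mod t" by simp
      hence "fst (g l) = fst (g l')" using gM(2)[of l] gM(2)[of l'] l by simp
      thus "l = l'" using inj l by simp
    qed
    show "inj_on (\<lambda>l\<in>{..<K}. snd (g l) mod t) {..<K}"
    proof (rule inj_onI)
      fix l l' assume l: "l \<in> {..<K}" "l' \<in> {..<K}"
        and "(\<lambda>l\<in>{..<K}. snd (g l) mod t) l = (\<lambda>l\<in>{..<K}. snd (g l) mod t) l'"
      hence "snd (g l) mod t = snd (g l') mod t" by simp
      hence "snd (g l) = snd (g l')" using gM(3)[of l] gM(3)[of l'] l by simp
      thus "l = l'" using inj l by simp
    qed
    show "(\<lambda>l\<in>{..<K}. fst (g l) mod t) \<in> {..<K} \<rightarrow>\<^sub>E {..<t}"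
      "(\<lambda>l\<in>{..<K}. snd (g l) mod t) \<in> {..<K} \<rightarrow>\<^sub>E {..<t}"
      using t by (simp_all add: restrict_PiE_iff)
    fix l assume l: "l < K"
    have "(fst u * t + fst (g l) mod t, snd u * t + snd (g l) mod t) = g l"
      by (rule prod_eqI) (simp_all only: fst_conv snd_conv gM(2,3)[OF l, symmetric])
    thus "(fst u * t + (\<lambda>l\<in>{..<K}. fst (g l) mod t) l, snd u * t + (\<lambda>l\<in>{..<K}. snd (g l) mod t) l) \<in> M"
      using gM(1)[OF l] l by simp
  qed
qed

text \<open>
  The numerical condition of the Kovari-Sos-Turan argument for \<open>m\<close> blocks per side and
  average degree about \<open>D\<close>: pigeonholing over \<open>t ^ (2 * K)\<close> position types and losing another
  factor \<open>t\<close> brings \<open>D\<close> down to \<open>n div t ^ (2 * K + 1)\<close>.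
\<close>

lemma grid_parameters:
  fixes K t n m :: nat
  assumes K: "2 \<le> K" and t: "(4 * K) ^ (K + 1) < t"
    and n: "t ^ ((2 * K + 1) * (K + 1) + 1) \<le> n" and m: "m \<le> 2 * n"
  defines "D \<equiv> n div t ^ (2 * K + 1)"
  shows "K * m ^ K < D * (D choose K)"
proof -
  define x where "x = t ^ (2 * K + 1)"
  have D: "D = n div x" unfolding D_def x_def ..
  have "4 * K \<le> (4 * K) ^ (K + 1)" using K by (intro self_le_power) auto
  hence t0: "0 < t" "K \<le> t" using t by linarith+
  have x0: "0 < x" "1 \<le> x" using t0 by (auto simp: x_def)
  have "t ^ ((2 * K + 1) * (K + 1) + 1) = t * x ^ (K + 1)"
    by (simp only: x_def power_mult[symmetric] power_Suc[symmetric] Suc_eq_plus1)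
  hence txn: "t * x ^ (K + 1) \<le> n" using n by (simp only:)
  have "x \<le> x ^ (K + 1)" using x0 by (intro self_le_power) auto
  hence "K * x \<le> n" using txn t0 by (meson le_trans mult_le_mono)
  hence KD: "K \<le> D" using x0 by (simp add: D less_eq_div_iff_mult_less_eq)
  \<comment> \<open>Rounding down in \<open>D\<close> loses at most a factor 2, since
    \<open>D \<ge> 1\<close>.\<close>
  have "n < (D + 1) * x" using x0 by (simp add: D dividend_less_div_times)
  also have "\<dots> \<le> 2 * D * x" using KD K by (intro mult_right_mono) auto
  finally have nD: "n \<le> 2 * D * x" by simp
  \<comment> \<open>Scaling by \<open>(2 * x) ^ (K + 1)\<close> avoids division:
    \<open>n ^ (K + 1)\<close> then separates the two sides. A spare factor 2 collects the constants
    into \<open>(4 * K) ^ (K + 1)\<close>, which \<open>t\<close> exceeds.\<close>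
  have "(2 * x) ^ (K + 1) * (K ^ (K + 1) * m ^ K) \<le> (2 * x) ^ (K + 1) * (K ^ (K + 1) * (2 * n) ^ K)"
    using m by (intro mult_left_mono power_mono) auto
  also have "\<dots> \<le> (2 * x) ^ (K + 1) * (K ^ (K + 1) * (2 ^ (K + 1) * n ^ K))"
    by (simp add: power_mult_distrib)
  also have "\<dots> = ((2 * 2 * K) ^ (K + 1) * x ^ (K + 1)) * n ^ K"
    unfolding power_mult_distrib by (simp only: ac_simps)
  also have "\<dots> = ((4 * K) ^ (K + 1) * x ^ (K + 1)) * n ^ K" by simp
  also have "\<dots> < (t * x ^ (K + 1)) * n ^ K"
  proof -
    have "0 < n" using txn t0 x0 by (metis gr0I mult_is_0 not_le power_not_zero)
    thus ?thesis using t x0 by simp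
  qed
  also have "\<dots> \<le> n * n ^ K" using txn by (intro mult_right_mono) auto
  also have "\<dots> = n ^ (K + 1)" by simp
  also have "\<dots> \<le> (2 * D * x) ^ (K + 1)" using nD by (rule power_mono) simp
  also have "\<dots> = (2 * x) ^ (K + 1) * D ^ (K + 1)" by (simp add: power_mult_distrib ac_simps)
  finally have lt: "K ^ (K + 1) * m ^ K < D ^ (K + 1)" using x0 by simp
  have "(real D / real K) ^ K \<le> real (D choose K)"
    by (rule binomial_ge_n_over_k_pow_k) (use KD in auto)
  hence "real (D ^ K) \<le> real (K ^ K * (D choose K))"
    using K by (simp add: power_divide field_simps)
  hence "D ^ K \<le> K ^ K * (D choose K)" by linarith
  hence "D * D ^ K \<le> D * (K ^ K * (D choose K))" by (rule mult_le_mono2)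
  with lt have "K ^ K * (K * m ^ K) < D * (K ^ K * (D choose K))" by (simp only: power_add power_one_right ac_simps)
  also have "\<dots> = K ^ K * (D * (D choose K))" by (simp only: ac_simps)
  finally show ?thesis by simp
qed

text \<open>Cells with fewer than \<open>K\<close> pairs account for at most
  \<open>4 * K * n\<^sup>2 / t\<close> pairs, half of what \<open>large\<close> guarantees. Once the
  offsets are fixed, a rich cell determines its \<open>b\<close> by \<open>unique\<close>, so rich
  cells can be treated as edges of a bipartite graph between blocks.\<close>

lemma matchings_contain_grid:
  fixes M :: "'b \<Rightarrow> (nat \<times> nat) set"
  assumes B: "finite B" "card B \<le> n"
    and sub: "\<And>b. b \<in> B \<Longrightarrow> M b \<subseteq> {..<n} \<times> {..<n}"
    and mono: "\<And>b. b \<in> B \<Longrightarrow> monotone_matching (M b)"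
    and unique: "\<And>b b' p q. \<lbrakk>b \<in> B; b' \<in> B; p \<in> M b; p \<in> M b'; q \<in> M b; q \<in> M b'; fst p \<noteq> fst q\<rbrakk> \<Longrightarrow> b = b'"
    and K: "2 \<le> K" and t: "(4 * K) ^ (K + 1) < t"
    and n: "t ^ ((2 * K + 1) * (K + 1) + 1) \<le> n"
    and large: "8 * K * n\<^sup>2 \<le> t * (\<Sum>b\<in>B. card (M b))"
  obtains \<alpha> \<beta> \<gamma> where
    "inj_on (\<lambda>(i, l). \<alpha> i l) ({..<K} \<times> {..<K})" "inj_on (\<lambda>(j, l). \<gamma> j l) ({..<K} \<times> {..<K})"
    "\<And>i j. i < K \<Longrightarrow> j < K \<Longrightarrow> \<beta> i j \<in> B"
    "\<And>i j l. i < K \<Longrightarrow> j < K \<Longrightarrow> l < K \<Longrightarrow> (\<alpha> i l, \<gamma> j l) \<in> M (\<beta> i j)"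
proof -
  \<comment> \<open>The extra block covers the remainder of \<open>n\<close> modulo
    \<open>t\<close>; since \<open>t \<le> n\<close>, still
    \<open>t * m \<le> 2 * n\<close>.\<close>
  define m where "m = n div t + 1"
  define x where "x = t ^ (2 * K + 1)"
  define D where "D = n div x"
  have t0: "0 < t" using t by simp
  have "t \<le> t ^ ((2 * K + 1) * (K + 1) + 1)" using t0 by (intro self_le_power) auto
  with n have tn: "t \<le> n" by linarith
  have "t * m = t * (n div t) + t" by (simp add: m_def)
  also have "\<dots> \<le> n + n" using tn by (intro add_mono) auto
  finally have tm: "t * m \<le> 2 * n" by simp
  moreover have "1 * m \<le> t * m" using t0 by (intro mult_right_mono) auto
  ultimately have m2n: "m \<le> 2 * n" by linarith
  have dens: "K * m ^ K < D * (D choose K)"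
    using grid_parameters[OF K t n m2n] by (simp add: D_def x_def)
  have boxsub: "cell t ` M b \<subseteq> {..<m} \<times> {..<m}" if "b \<in> B" for b
  proof (rule image_subsetI)
    fix p assume "p \<in> M b"
    hence "fst p \<le> n" "snd p \<le> n" using sub[OF that] by auto
    hence "fst p div t \<le> n div t" "snd p div t \<le> n div t" by (simp_all add: div_le_mono)
    thus "cell t p \<in> {..<m} \<times> {..<m}" by (simp add: cell_def m_def)
  qed
  define rich where "rich b = {u \<in> {..<m} \<times> {..<m}. K \<le> card {p \<in> M b. cell t p = u}}" for b
  define R where "R = Sigma B rich"
  have finrich: "finite (rich b)" for b by (simp add: rich_def)
  have finR: "finite R" using B finrich by (simp add: R_def)
  have cardR: "card R = (\<Sum>b\<in>B. card (rich b))" using B finrich by (simp add: R_def)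
  have "(\<Sum>b\<in>B. card (M b)) \<le> (\<Sum>b\<in>B. 2 * m * K + t * card (rich b))"
    unfolding rich_def by (intro sum_mono card_matching_le mono boxsub t0)
  also have "\<dots> = card B * (2 * m * K) + t * card R"
    by (simp add: sum.distrib cardR sum_distrib_left)
  also have "\<dots> \<le> n * (2 * m * K) + t * card R" using B by simp
  finally have "t * (\<Sum>b\<in>B. card (M b)) \<le> t * (n * (2 * m * K) + t * card R)" by simp
  also have "\<dots> = 2 * K * n * (t * m) + t\<^sup>2 * card R" by (simp add: algebra_simps power2_eq_square)
  also have "\<dots> \<le> 2 * K * n * (2 * n) + t\<^sup>2 * card R"
    by (intro add_right_mono mult_left_mono tm) simp
  finally have "8 * K * n\<^sup>2 \<le> 4 * K * n\<^sup>2 + t\<^sup>2 * card R"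
    using large by (simp add: power2_eq_square)
  hence R1: "4 * K * n\<^sup>2 \<le> t\<^sup>2 * card R" by linarith

  \<comment> \<open>Fixing the positions inside the blocks makes the sets attached to different blocks disjoint.\<close>
  define Ty where "Ty = ({..<K} \<rightarrow>\<^sub>E {..<t}) \<times> ({..<K} \<rightarrow>\<^sub>E {..<t})"
  define good where "good s b u \<longleftrightarrow> inj_on (fst s) {..<K} \<and> inj_on (snd s) {..<K} \<and>
     (\<forall>l<K. (fst u * t + fst s l, snd u * t + snd s l) \<in> M b)" for s :: "(nat \<Rightarrow> nat) \<times> (nat \<Rightarrow> nat)" and b and u :: "nat \<times> nat"
  define Q where "Q s = {(b, u). (b, u) \<in> R \<and> good s b u}" for s
  have finTy: "finite Ty" by (simp add: Ty_def finite_PiE)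
  have cardTy: "card Ty = t ^ (2 * K)"
    by (simp add: Ty_def card_cartesian_product card_PiE power_add mult_2)
  have "R \<subseteq> (\<Union>s\<in>Ty. Q s)"
  proof safe
    fix b i j assume bu: "(b, (i, j)) \<in> R"
    hence b: "b \<in> B" "K \<le> card {p \<in> M b. cell t p = (i, j)}" by (auto simp: R_def rich_def)
    obtain \<sigma> \<tau> where "\<sigma> \<in> {..<K} \<rightarrow>\<^sub>E {..<t}" "\<tau> \<in> {..<K} \<rightarrow>\<^sub>E {..<t}"
      "inj_on \<sigma> {..<K}" "inj_on \<tau> {..<K}"
      "\<And>l. l < K \<Longrightarrow> (fst (i, j) * t + \<sigma> l, snd (i, j) * t + \<tau> l) \<in> M b"
      using rich_box_type[OF mono[OF b(1)] t0 b(2)] by blast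
    thus "(b, (i, j)) \<in> (\<Union>s\<in>Ty. Q s)"
      using bu by (intro UN_I[of "(\<sigma>, \<tau>)"]) (auto simp: Ty_def Q_def good_def)
  qed
  hence "card R \<le> card (\<Union>s\<in>Ty. Q s)"
    using finTy finR by (intro card_mono finite_UN_I) (auto simp: Q_def elim: finite_subset[rotated])
  also have "\<dots> \<le> (\<Sum>s\<in>Ty. card (Q s))" by (rule card_UN_le[OF finTy])
  finally have RQ: "card R \<le> (\<Sum>s\<in>Ty. card (Q s))" .
  have "\<exists>s\<in>Ty. card R \<le> t ^ (2 * K) * card (Q s)"
  proof (rule ccontr)
    assume neg: "\<not> ?thesis"
    have ne: "Ty \<noteq> {}" using cardTy t0 by (metis card.empty power_not_zero less_irrefl)
    have "t ^ (2 * K) * card R \<le> (\<Sum>s\<in>Ty. t ^ (2 * K) * card (Q s))"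
      using RQ by (simp flip: sum_distrib_left)
    also have "\<dots> < (\<Sum>s\<in>Ty. card R)" using neg finTy ne by (intro sum_strict_mono) auto
    finally show False by (simp add: cardTy)
  qed
  then obtain s where s: "s \<in> Ty" "card R \<le> t ^ (2 * K) * card (Q s)" by blast
  define E where "E = snd ` Q s"
  \<comment> \<open>\<open>K \<ge> 2\<close> provides two pairs with different first coordinates,
    which depend only on the cell and on \<open>s\<close> and determine \<open>b\<close>. Hence
    passing from \<open>Q s\<close> to the edge set \<open>E\<close> loses nothing.\<close>
  have "inj_on snd (Q s)"
  proof (rule inj_onI)
    fix v w assume Q: "v \<in> Q s" "w \<in> Q s" and eq: "snd v = snd w"
    define p where "p l = (fst (snd v) * t + fst s l, snd (snd v) * t + snd s l)" for l
    have inB: "fst v \<in> B" "fst w \<in> B" using Q by (auto simp: Q_def R_def)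
    have inM: "p l \<in> M (fst v)" "p l \<in> M (fst w)" if "l < K" for l
      using Q eq that by (auto simp: Q_def good_def p_def)
    have "inj_on (fst s) {..<K}" using Q by (auto simp: Q_def good_def)
    hence "fst s 0 \<noteq> fst s 1" using K inj_onD[of "fst s" "{..<K}" 0 1] by auto
    hence "fst v = fst w" using inB inM[of 0] inM[of 1] K by (intro unique[of _ _ "p 0" "p 1"]) (auto simp: p_def)
    thus "v = w" using eq by (rule prod_eqI)
  qed
  hence cardE: "card E = card (Q s)" by (simp add: E_def card_image)
  have Esub: "E \<subseteq> {..<m} \<times> {..<m}" by (auto simp: E_def Q_def R_def rich_def)
  \<comment> \<open>The losses \<open>t\<^sup>2\<close> from \<open>R1\<close> and
    \<open>t ^ (2 * K)\<close> from the choice of \<open>s\<close> amount to \<open>x * t\<close>;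
    \<open>x\<close> is absorbed by \<open>D * x \<le> n\<close> and \<open>t\<close> by
    \<open>t * m \<le> 2 * n\<close>.\<close>
  have "t\<^sup>2 * t ^ (2 * K) * (2 * D * m) = 2 * (D * x) * (t * m)"
    by (simp add: x_def power2_eq_square)
  also have "\<dots> \<le> 2 * n * (2 * n)"
    by (intro mult_le_mono tm order_refl) (simp add: D_def)
  also have "\<dots> \<le> 4 * K * n\<^sup>2" using K by (simp add: power2_eq_square)
  also have "\<dots> \<le> t\<^sup>2 * card R" by (rule R1)
  also have "\<dots> \<le> t\<^sup>2 * t ^ (2 * K) * card E" using s(2) by (simp add: cardE)
  finally have "2 * D * m \<le> card E" using t0 by simp
  then obtain S T where ST: "S \<subseteq> {..<m}" "T \<subseteq> {..<m}" "card S = K" "card T = K" "S \<times> T \<subseteq> E"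
    using kovari_sos_turan[of "{..<m}" m "{..<m}" E D K] Esub dens by (auto simp: m_def)
  have "finite S" "finite T" using ST finite_subset by blast+
  then obtain f g where f: "bij_betw f {..<K} S" and g: "bij_betw g {..<K} T"
    using ST(3,4) by (metis ex_bij_betw_nat_finite lessThan_atLeast0)
  have "\<exists>b. (b, (f i, g j)) \<in> Q s" if "i < K" "j < K" for i j
  proof -
    have "(f i, g j) \<in> E" using that ST(5) f g by (auto simp: bij_betw_def)
    thus ?thesis by (auto simp: E_def)
  qed
  then obtain \<beta> where \<beta>: "\<And>i j. i < K \<Longrightarrow> j < K \<Longrightarrow> (\<beta> i j, (f i, g j)) \<in> Q s" by metis
  \<comment> \<open>Offsets are below \<open>t\<close>, so quotient and remainder modulo
    \<open>t\<close> recover the block and the offset.\<close>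
  have inj: "inj_on (\<lambda>(i, l). h i * t + r l) ({..<K} \<times> {..<K})"
    if h: "inj_on h {..<K}" and r: "inj_on r {..<K}" "r \<in> {..<K} \<rightarrow>\<^sub>E {..<t}" for h r :: "nat \<Rightarrow> nat"
  proof (rule inj_onI, safe)
    fix i l i' l' assume lt: "i < K" "l < K" "i' < K" "l' < K" and eq: "h i * t + r l = h i' * t + r l'"
    have "r l < t" "r l' < t" using r lt by auto
    hence "h i = h i'" "r l = r l'"
      using arg_cong[OF eq, of "\<lambda>v. v div t"] arg_cong[OF eq, of "\<lambda>v. v mod t"] by simp_all
    thus "i = i'" "l = l'" using h r lt by (auto simp: inj_on_def)
  qed
  have "inj_on (fst s) {..<K}" "inj_on (snd s) {..<K}"
    using \<beta>[of 0 0] K by (auto simp: Q_def good_def)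
  moreover have "fst s \<in> {..<K} \<rightarrow>\<^sub>E {..<t}" "snd s \<in> {..<K} \<rightarrow>\<^sub>E {..<t}"
    using s(1) by (simp_all add: Ty_def mem_Times_iff)
  ultimately have
    "inj_on (\<lambda>(i, l). f i * t + fst s l) ({..<K} \<times> {..<K})"
    "inj_on (\<lambda>(j, l). g j * t + snd s l) ({..<K} \<times> {..<K})"
    using inj[of f] inj[of g] bij_betw_imp_inj_on[OF f] bij_betw_imp_inj_on[OF g] by blast+
  thus ?thesis
  proof (rule that[of "\<lambda>i l. f i * t + fst s l" "\<lambda>j l. g j * t + snd s l" \<beta>])
    fix i j assume "i < K" "j < K"
    thus "\<beta> i j \<in> B" using \<beta>[of i j] by (simp add: Q_def R_def)
  next
    fix i j l assume "i < K" "j < K" "l < K"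
    thus "(f i * t + fst s l, g j * t + snd s l) \<in> M (\<beta> i j)"
      using \<beta>[of i j] by (simp add: Q_def good_def)
  qed
qed

subsection \<open>Projections through a point\<close>

text \<open>The sign of \<open>det2 (q - p) (w - p)\<close> tells on which side of the line through
  \<open>p\<close> and \<open>q\<close> the point \<open>w\<close> lies.\<close>

definition det2 :: "real^2 \<Rightarrow> real^2 \<Rightarrow> real" where
  "det2 u v = u $ 1 * v $ 2 - u $ 2 * v $ 1"

lemma det2_scaleR_left: "det2 (r *\<^sub>R u) v = r * det2 u v"
  and det2_scaleR_right: "det2 u (r *\<^sub>R v) = r * det2 u v"
  and det2_add_right: "det2 u (v + w) = det2 u v + det2 u w"
  and det2_diff_right: "det2 u (v - w) = det2 u v - det2 u w"
  and det2_self: "det2 u u = 0"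
  and det2_commute: "det2 u v = - det2 v u"
  by (simp_all add: det2_def algebra_simps)

lemma det2_eq_0_imp_scaleR:
  assumes "det2 u v = 0" "u \<noteq> 0"
  shows "\<exists>r. v = r *\<^sub>R u"
proof -
  \<comment> \<open>The difference of the two sides is \<open>det2 u v\<close> times
    \<open>u\<close> turned by a right angle.\<close>
  have "(u \<bullet> u) *\<^sub>R v = (u \<bullet> v) *\<^sub>R u"
    using assms(1) by (simp add: vec_eq_iff forall_2 inner_vec_def UNIV_2 det2_def algebra_simps)
  hence "v = ((u \<bullet> v) / (u \<bullet> u)) *\<^sub>R u"
    using assms(2) by (simp add: eq_vector_fraction_iff)
  thus ?thesis by blast
qed

section \<open>Avoidance in terms of orientation\<close>

lemma mem_affine_hull_if_det2_eq_0:
  assumes "det2 (q - p) (w - p) = 0" "p \<noteq> q"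
  shows "w \<in> affine hull {p, q}"
proof -
  obtain r where "w - p = r *\<^sub>R (q - p)" using det2_eq_0_imp_scaleR[OF assms(1)] assms(2) by auto
  hence "w = p + r *\<^sub>R (q - p)" by (simp add: algebra_simps)
  thus ?thesis by (auto simp: affine_hull_2_alt)
qed

text \<open>\<open>det2 (q - p) (w - p)\<close> is affine in \<open>w\<close>. Without a common
  strict sign at \<open>y\<close> and \<open>z\<close> it would vanish somewhere on the segment
  between them, that is, at a point of the hull of \<open>Y\<close> on the line through
  \<open>p\<close> and \<open>q\<close>.\<close>

lemma line_avoiding_same_side:
  assumes av: "line_avoiding X Y" and pq: "p \<in> X" "q \<in> X" "p \<noteq> q" and yz: "y \<in> Y" "z \<in> Y"
  shows "0 < det2 (q - p) (y - p) * det2 (q - p) (z - p)"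
proof (rule ccontr)
  let ?u = "det2 (q - p) (y - p)" and ?v = "det2 (q - p) (z - p)"
  assume "\<not> ?thesis"
  hence uv: "?u * ?v \<le> 0" by simp
  have off: "det2 (q - p) (w - p) \<noteq> 0" if "w \<in> convex hull Y" for w
    using av pq that mem_affine_hull_if_det2_eq_0[of q p w] by (auto simp: line_avoiding_def)
  have ne: "?u - ?v \<noteq> 0"
  proof
    assume "?u - ?v = 0"
    hence "?u * ?u \<le> 0" using uv by simp
    hence "?u = 0" by (metis mult_le_0_iff order_antisym)
    thus False using off[of y] yz by (simp add: hull_inc)
  qed
  \<comment> \<open>The parameter at which the affine function with values \<open>?u\<close> at
    \<open>y\<close> and \<open>?v\<close> at \<open>z\<close> vanishes.\<close>
  define r where "r = ?u / (?u - ?v)"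
  have "0 \<le> r \<and> r \<le> 1"
  proof (cases "?u \<ge> 0")
    case True
    hence "?u = 0 \<or> ?v \<le> 0" using uv by (auto simp: mult_le_0_iff)
    thus ?thesis using True ne unfolding r_def by (auto simp: divide_simps)
  next
    case False
    hence "?v \<ge> 0" using uv by (auto simp: mult_le_0_iff)
    thus ?thesis using False ne unfolding r_def by (auto simp: divide_simps)
  qed
  hence "(1 - r) *\<^sub>R y + r *\<^sub>R z \<in> convex hull Y"
    using yz by (intro convexD[OF convex_convex_hull]) (auto simp: hull_inc)
  moreover have "(1 - r) *\<^sub>R y + r *\<^sub>R z - p = (y - p) + r *\<^sub>R ((z - p) - (y - p))"
    by (simp add: algebra_simps)
  hence "det2 (q - p) ((1 - r) *\<^sub>R y + r *\<^sub>R z - p) = ?u + r * (?v - ?u)"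
    by (simp only: det2_add_right det2_scaleR_right det2_diff_right)
  hence "det2 (q - p) ((1 - r) *\<^sub>R y + r *\<^sub>R z - p) = 0"
    using ne by (simp add: r_def field_simps)
  ultimately show False using off by blast
qed

text \<open>
  Since \<open>X\<close> lies strictly on one side of the line \<open>y\<^sub>0 y\<^sub>1\<close>, the angular order of \<open>X\<close> as seen from
  \<open>y\<^sub>0\<close> is measured by a cotangent; by avoidance, every other point of \<open>Y\<close> sees the same order.
\<close>

lemma sight_order_key:
  assumes XY: "line_avoiding X Y" and YX: "line_avoiding Y X"
    and y: "y\<^sub>0 \<in> Y" "y\<^sub>1 \<in> Y" "y\<^sub>0 \<noteq> y\<^sub>1"
  obtains f :: "real^2 \<Rightarrow> real"
  where "\<And>p q y. \<lbrakk>p \<in> X; q \<in> X; p \<noteq> q; y \<in> Y\<rbrakk> \<Longrightarrow> 0 < (f q - f p) * det2 (q - p) (y - p)"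
proof -
  define d where "d = y\<^sub>1 - y\<^sub>0"
  define f where "f p = - ((p - y\<^sub>0) \<bullet> d / det2 d (p - y\<^sub>0))" for p
  have "0 < (f q - f p) * det2 (q - p) (y - p)"
    if pq: "p \<in> X" "q \<in> X" "p \<noteq> q" and "y \<in> Y" for p q y
  proof -
    let ?u = "p - y\<^sub>0" and ?v = "q - y\<^sub>0"
    have side: "0 < det2 d ?u * det2 d ?v"
      unfolding d_def by (rule line_avoiding_same_side[OF YX y pq(1,2)])
    \<comment> \<open>This amounts to the formula for a difference of cotangents. With
      \<open>side\<close> it gives \<open>f q - f p\<close> the sign of \<open>det2 ?u ?v\<close>,
      the orientation of the triangle \<open>y\<^sub>0\<close>, \<open>p\<close>,
      \<open>q\<close>.\<close>
    have "?u \<bullet> d * det2 d ?v - ?v \<bullet> d * det2 d ?u = (d \<bullet> d) * det2 ?u ?v"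
      by (simp add: det2_def inner_vec_def UNIV_2 algebra_simps)
    moreover have "det2 d ?u \<noteq> 0" "det2 d ?v \<noteq> 0" using side by auto
    ultimately have "f q - f p = (d \<bullet> d) * det2 ?u ?v / (det2 d ?u * det2 d ?v)"
      by (simp add: f_def diff_frac_eq)
    also have "det2 ?u ?v = det2 (q - p) (y\<^sub>0 - p)"
      by (simp add: det2_def algebra_simps)
    finally have eq: "(f q - f p) * det2 (q - p) (y - p) =
      (d \<bullet> d) / (det2 d ?u * det2 d ?v) * (det2 (q - p) (y\<^sub>0 - p) * det2 (q - p) (y - p))"
      by simp
    have "0 < (d \<bullet> d) / (det2 d ?u * det2 d ?v)"
      using side y by (simp add: d_def)
    thus ?thesis unfolding eq
      by (intro mult_pos_pos line_avoiding_same_side[OF XY pq y(1) \<open>y \<in> Y\<close>])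
  qed
  thus ?thesis by (rule that)
qed

lemma line_avoiding_det2_neq_0:
  assumes "line_avoiding X Y" "p \<in> X" "q \<in> X" "p \<noteq> q" "y \<in> Y"
  shows "det2 (p - y) (q - y) \<noteq> 0"
proof -
  have "0 < det2 (q - p) (y - p) * det2 (q - p) (y - p)"
    using assms by (intro line_avoiding_same_side)
  moreover have "det2 (q - p) (y - p) = det2 (p - y) (q - y)"
    by (simp add: det2_def algebra_simps)
  ultimately show ?thesis by auto
qed

text \<open>A common point would lie on the line joining it to a second point of
  \<open>X\<close>.\<close>

lemma line_avoiding_disjoint:
  assumes "line_avoiding X Y" "p \<in> X" "q \<in> X" "p \<noteq> q" "y \<in> Y" "x \<in> X"
  shows "x \<noteq> y"
proof -
  have "\<exists>x'\<in>X. x' \<noteq> x" using assms by metis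
  then obtain x' where "x' \<in> X" "x' \<noteq> x" by blast
  thus ?thesis
    using line_avoiding_det2_neq_0[OF assms(1,6) \<open>x' \<in> X\<close> _ assms(5)] by (auto simp: det2_def)
qed

text \<open>\<open>f\<close> and \<open>g\<close> are keys as in \<open>sight_order_key\<close>,
  ordering \<open>A\<close> as seen from \<open>C\<close> and \<open>C\<close> as seen from
  \<open>A\<close>. By \<open>A2\<close> and \<open>C2\<close> both sets determine lines, so that
  avoidance has content.\<close>

locale avoiding_sets =
  fixes A B C :: "(real^2) set" and f g :: "real^2 \<Rightarrow> real"
  assumes AC: "line_avoiding A C" and CA: "line_avoiding C A"
    and AB: "line_avoiding A B" and CB: "line_avoiding C B"
    and A2: "\<exists>p\<in>A. \<exists>q\<in>A. p \<noteq> q" and C2: "\<exists>p\<in>C. \<exists>q\<in>C. p \<noteq> q"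
    and f: "\<And>p q y. \<lbrakk>p \<in> A; q \<in> A; p \<noteq> q; y \<in> C\<rbrakk> \<Longrightarrow> 0 < (f q - f p) * det2 (q - p) (y - p)"
    and g: "\<And>p q y. \<lbrakk>p \<in> C; q \<in> C; p \<noteq> q; y \<in> A\<rbrakk> \<Longrightarrow> 0 < (g q - g p) * det2 (q - p) (y - p)"
begin

section \<open>Collinear triples through a point of \<open>B\<close>\<close>

lemma inj_key: "inj_on f A" "inj_on g C"
  using f g A2 C2 by (fastforce simp: inj_on_def)+

text \<open>Neither \<open>a\<close> nor \<open>c\<close> equals \<open>b\<close>, so a homothety
  with centre \<open>b\<close> takes \<open>a\<close> to \<open>c\<close>; its ratio
  \<open>s\<close> is negative exactly when \<open>b\<close> separates \<open>a\<close> from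
  \<open>c\<close>.\<close>

lemma triple_ratio:
  assumes "(a, b, c) \<in> collinear_triples A B C"
  obtains s where "c = b + s *\<^sub>R (a - b)" "s \<noteq> 0"
proof -
  have abc: "a \<in> A" "b \<in> B" "c \<in> C" "collinear {a, b, c}"
    using assms by (auto simp: collinear_triples_def)
  have "a \<noteq> b" using A2 line_avoiding_disjoint[OF AB _ _ _ abc(2,1)] by blast
  moreover have "c \<noteq> b" using C2 line_avoiding_disjoint[OF CB _ _ _ abc(2,3)] by blast
  moreover have "collinear {0, a - b, c - b}" using abc(4) collinear_3[of a b c] by simp
  ultimately obtain s where s: "c - b = s *\<^sub>R (a - b)" by (auto simp: collinear_lemma)
  show ?thesis
  proof (rule that)
    show "c = b + s *\<^sub>R (a - b)" using s by (simp add: algebra_simps)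
    show "s \<noteq> 0" using s \<open>c \<noteq> b\<close> by auto
  qed
qed

text \<open>Seen from \<open>b\<close>, the determinants of \<open>c\<close>, \<open>c'\<close> and
  of \<open>a\<close>, \<open>a'\<close> differ by the nonzero factor \<open>s * s'\<close>, and by
  avoidance each vanishes only when its two points coincide.\<close>

lemma triple_eq_iff:
  assumes "(a, b, c) \<in> collinear_triples A B C" "(a', b, c') \<in> collinear_triples A B C"
  shows "a = a' \<longleftrightarrow> c = c'"
proof -
  have mem: "a \<in> A" "a' \<in> A" "b \<in> B" "c \<in> C" "c' \<in> C"
    using assms by (auto simp: collinear_triples_def)
  obtain s where s: "c = b + s *\<^sub>R (a - b)" "s \<noteq> 0" by (rule triple_ratio[OF assms(1)])
  obtain s' where s': "c' = b + s' *\<^sub>R (a' - b)" "s' \<noteq> 0" by (rule triple_ratio[OF assms(2)])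
  have "det2 (c - b) (c' - b) = s * s' * det2 (a - b) (a' - b)"
    by (simp add: s s' det2_scaleR_left det2_scaleR_right)
  moreover have "a \<noteq> a' \<Longrightarrow> det2 (a - b) (a' - b) \<noteq> 0"
    using line_avoiding_det2_neq_0[OF AB] mem by blast
  moreover have "c \<noteq> c' \<Longrightarrow> det2 (c - b) (c' - b) \<noteq> 0"
    using line_avoiding_det2_neq_0[OF CB] mem by blast
  ultimately show ?thesis using s(2) s'(2) det2_self by (metis mult_eq_0_iff)
qed

text \<open>
  The sign of \<open>(a - b) \<bullet> (c - b)\<close> tells whether \<open>b\<close> separates \<open>a\<close> from \<open>c\<close>; it is the same for all
  triples through \<open>b\<close> and decides whether projecting \<open>A\<close> to \<open>C\<close> through \<open>b\<close> reverses the order.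
\<close>

lemma triple_pair_sign:
  assumes abc: "(a, b, c) \<in> collinear_triples A B C" "(a', b, c') \<in> collinear_triples A B C"
    and ne: "a \<noteq> a'"
  shows "(f a' - f a) * (g c' - g c) * ((a - b) \<bullet> (c - b)) < 0"
    and "0 < ((a - b) \<bullet> (c - b)) * ((a' - b) \<bullet> (c' - b))"
proof -
  have mem: "a \<in> A" "a' \<in> A" "b \<in> B" "c \<in> C" "c' \<in> C"
    using abc by (auto simp: collinear_triples_def)
  have ne': "c \<noteq> c'" using triple_eq_iff[OF abc] ne by simp
  obtain s where s: "c = b + s *\<^sub>R (a - b)" "s \<noteq> 0" by (rule triple_ratio[OF abc(1)])
  obtain s' where s': "c' = b + s' *\<^sub>R (a' - b)" "s' \<noteq> 0" by (rule triple_ratio[OF abc(2)])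
  define d where "d = det2 (a - b) (a' - b)"
  have d: "d \<noteq> 0" unfolding d_def using line_avoiding_det2_neq_0[OF AB] mem ne by blast
  \<comment> \<open>Since \<open>c - a\<close> is \<open>1 - s\<close> times \<open>b - a\<close>,
    and likewise for \<open>a'\<close> and \<open>c'\<close>, all four orientations are multiples of
    \<open>d\<close>.\<close>
  have e1: "det2 (a' - a) (c - a) = (1 - s) * d"
    and e2: "det2 (a' - a) (c' - a) = (1 - s') * d"
    and e3: "det2 (c' - c) (a - c) = - ((1 - s) * s' * d)"
    and e4: "det2 (c' - c) (a' - c) = - ((1 - s') * s * d)"
    by (simp_all add: s s' d_def det2_def algebra_simps)
  have p1: "0 < (f a' - f a) * ((1 - s) * d)" using f[OF mem(1,2) ne mem(4)] e1 by simp
  have p2: "0 < (1 - s) * d * ((1 - s') * d)"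
    using line_avoiding_same_side[OF AC mem(1,2) ne mem(4,5)] e1 e2 by simp
  have p3: "0 < (g c' - g c) * - ((1 - s) * s' * d)" using g[OF mem(4,5) ne' mem(1)] e3 by simp
  have p4: "0 < ((1 - s) * s' * d) * ((1 - s') * s * d)"
    using line_avoiding_same_side[OF CA mem(4,5) ne' mem(1,2)] e3 e4 by simp
  have ab: "0 < (a - b) \<bullet> (a - b)" "0 < (a' - b) \<bullet> (a' - b)"
    using d by (auto simp: d_def det2_def)
  \<comment> \<open>The products in \<open>p2\<close> and \<open>p4\<close> differ by the factor
    \<open>s * s'\<close>, so \<open>b\<close> separates both pairs or neither.\<close>
  have "((1 - s) * s' * d) * ((1 - s') * s * d) = (s * s') * ((1 - s) * d * ((1 - s') * d))"
    by simp
  hence ss: "0 < s * s'" using p2 p4 by (metis zero_less_mult_pos2)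
  \<comment> \<open>In this product everything but
    \<open>- ((f a' - f a) * (g c' - g c) * s)\<close> is a square, and \<open>s\<close> has the
    sign of \<open>(a - b) \<bullet> (c - b)\<close>.\<close>
  have "0 < ((f a' - f a) * ((1 - s) * d)) * ((g c' - g c) * - ((1 - s) * s' * d)) * (s * s')"
    by (rule mult_pos_pos[OF mult_pos_pos[OF p1 p3] ss])
  also have "\<dots> = - ((f a' - f a) * (g c' - g c) * s) * (((1 - s) * d * s')\<^sup>2)"
    by (simp add: power2_eq_square)
  finally have "0 < - ((f a' - f a) * (g c' - g c) * s)"
    by (metis zero_le_power2 mult_nonpos_nonneg not_le)
  thus "(f a' - f a) * (g c' - g c) * ((a - b) \<bullet> (c - b)) < 0"
    using ab(1) s by (simp add: mult_neg_pos flip: mult.assoc)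
  have "((a - b) \<bullet> (c - b)) * ((a' - b) \<bullet> (c' - b)) =
      (s * s') * (((a - b) \<bullet> (a - b)) * ((a' - b) \<bullet> (a' - b)))"
    using s s' by simp
  thus "0 < ((a - b) \<bullet> (c - b)) * ((a' - b) \<bullet> (c' - b))"
    using ss ab by (metis mult_pos_pos)
qed

text \<open>The line through \<open>a\<close> and \<open>c\<close> and the line through
  \<open>a'\<close> and \<open>c'\<close> both contain \<open>b\<close> and \<open>b'\<close>. By
  avoidance they leave \<open>b\<close> in independent directions, so they meet only once.\<close>

lemma triples_through_same_point:
  assumes "(a, b, c) \<in> collinear_triples A B C" "(a', b, c') \<in> collinear_triples A B C"
    and "(a, b', c) \<in> collinear_triples A B C" "(a', b', c') \<in> collinear_triples A B C"
    and ne: "a \<noteq> a'"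
  shows "b = b'"
proof -
  have on_line: "det2 (x - b) (b' - b) = 0"
    if x: "(x, b, z) \<in> collinear_triples A B C" "(x, b', z) \<in> collinear_triples A B C" for x z
  proof -
    have mem: "x \<in> A" "z \<in> C" using x by (auto simp: collinear_triples_def)
    obtain s where s: "z = b + s *\<^sub>R (x - b)" "s \<noteq> 0" by (rule triple_ratio[OF x(1)])
    obtain s' where s': "z = b' + s' *\<^sub>R (x - b')" "s' \<noteq> 0" by (rule triple_ratio[OF x(2)])
    have "x \<noteq> z" using A2 line_avoiding_disjoint[OF AC _ _ _ mem(2,1)] by blast
    hence "s \<noteq> 1" using s by auto
    have "0 = det2 (x - b') (z - b')" by (simp add: s' det2_scaleR_right det2_self)
    also have "\<dots> = (s - 1) * det2 (x - b) (b' - b)"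
      by (simp add: s det2_def algebra_simps)
    finally show ?thesis using \<open>s \<noteq> 1\<close> by simp
  qed
  have mem: "a \<in> A" "a' \<in> A" "b \<in> B" using assms by (auto simp: collinear_triples_def)
  have d: "det2 (a - b) (a' - b) \<noteq> 0" using line_avoiding_det2_neq_0[OF AB mem(1,2) ne mem(3)] .
  have "a - b \<noteq> 0" using d by (auto simp: det2_def)
  then obtain r where r: "b' - b = r *\<^sub>R (a - b)"
    using det2_eq_0_imp_scaleR[OF on_line[OF assms(1,3)]] by blast
  have "r * det2 (a' - b) (a - b) = 0"
    using on_line[OF assms(2,4)] by (simp add: r det2_scaleR_right)
  hence "r = 0" using d det2_commute[of "a - b"] by auto
  thus ?thesis using r by simp
qed

end

subsection \<open>From triples to systems\<close>

lemma sorted_enumeration: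
  fixes f :: "'a \<Rightarrow> real"
  assumes "finite A" "inj_on f A"
  obtains \<alpha> where "bij_betw \<alpha> {..<card A} A"
    "\<And>i j. i < card A \<Longrightarrow> j < card A \<Longrightarrow> f (\<alpha> i) < f (\<alpha> j) \<longleftrightarrow> i < j"
proof -
  define xs where "xs = sorted_list_of_set (f ` A)"
  have xs: "sorted_wrt (<) xs" "distinct xs" "set xs = f ` A" "length xs = card A"
    using assms by (simp_all add: xs_def card_image)
  have "bij_betw ((!) xs) {..<card A} (f ` A)" using xs by (intro bij_betw_nth) auto
  moreover have "bij_betw (inv_into A f) (f ` A) A"
    using assms(2) by (intro bij_betw_inv_into) (simp add: bij_betw_def)
  ultimately have bij: "bij_betw (inv_into A f \<circ> (!) xs) {..<card A} A" by (rule bij_betw_trans)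
  have val: "f ((inv_into A f \<circ> (!) xs) i) = xs ! i" if "i < card A" for i
    using that xs nth_mem[of i xs] by (simp add: f_inv_into_f)
  have less: "xs ! i < xs ! j" if "i < j" "j < card A" for i j
    using sorted_wrt_nth_less[OF xs(1) that(1)] that(2) xs(4) by simp
  show ?thesis
  proof (rule that[OF bij])
    fix i j assume "i < card A" "j < card A"
    thus "f ((inv_into A f \<circ> (!) xs) i) < f ((inv_into A f \<circ> (!) xs) j) \<longleftrightarrow> i < j"
      using val less[of i j] less[of j i] by (cases i j rule: linorder_cases) auto
  qed
qed

text \<open>Joint injectivity yields both the distinctness inside each set and the disjointness of
  different sets; indices from \<open>k\<close> on are dropped.\<close>

lemma has_k_systemI:
  assumes a: "inj_on (\<lambda>(i, l). a i l) ({..<K} \<times> {..<K})"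
    and c: "inj_on (\<lambda>(j, l). c j l) ({..<K} \<times> {..<K})"
    and k: "k \<le> K"
    and b: "\<And>i j. \<lbrakk>i < K; j < K\<rbrakk> \<Longrightarrow> b i j \<in> B"
    and tri: "\<And>i j l. \<lbrakk>i < K; j < K; l < K\<rbrakk> \<Longrightarrow> (a i l, b i j, c j l) \<in> collinear_triples A B C"
  shows "has_k_system k A B C"
proof -
  have a_eq: "a i l = a i' l' \<longleftrightarrow> i = i' \<and> l = l'" if "i < K" "i' < K" "l < K" "l' < K" for i i' l l'
    using inj_on_eq_iff[OF a, of "(i, l)" "(i', l')"] that by simp
  have c_eq: "c j l = c j' l' \<longleftrightarrow> j = j' \<and> l = l'" if "j < K" "j' < K" "l < K" "l' < K" for j j' l l'
    using inj_on_eq_iff[OF c, of "(j, l)" "(j', l')"] that by simp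
  have mem: "a i l \<in> A" "c i l \<in> C" if "i < K" "l < K" for i l
    using tri[of i i l] that by (auto simp: collinear_triples_def)
  \<comment> \<open>Indices are shifted to start from 1, and each \<open>c j\<close> is listed
    backwards: its entry at \<open>k - l + 1\<close> has position
    \<open>k - (k - l + 1) = l - 1\<close>, the same as in \<open>a\<close>.\<close>
  let ?a = "\<lambda>i l. a (i - 1) (l - 1)" and ?b = "\<lambda>i j. b (i - 1) (j - 1)"
    and ?c = "\<lambda>j l. c (j - 1) (k - l)"
  have "\<forall>i\<in>{1..k}. ?a i ` {1..k} \<subseteq> A \<and> card (?a i ` {1..k}) = k"
  proof
    fix i assume that: "i \<in> {1..k}"
    have "inj_on (?a i) {1..k}"
      by (rule inj_onI) (use that k in \<open>auto simp: a_eq\<close>)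
    thus "?a i ` {1..k} \<subseteq> A \<and> card (?a i ` {1..k}) = k"
      using that k mem by (auto simp: card_image)
  qed
  moreover have "\<forall>j\<in>{1..k}. ?c j ` {1..k} \<subseteq> C \<and> card (?c j ` {1..k}) = k"
  proof
    fix j assume that: "j \<in> {1..k}"
    have "inj_on (?c j) {1..k}"
      by (rule inj_onI) (use that k in \<open>auto simp: c_eq\<close>)
    thus "?c j ` {1..k} \<subseteq> C \<and> card (?c j ` {1..k}) = k"
      using that k mem by (auto simp: card_image)
  qed
  moreover have "disjoint_family_on (\<lambda>i. ?a i ` {1..k}) {1..k}"
    unfolding disjoint_family_on_def
  proof (intro ballI impI)
    fix i i' assume i: "i \<in> {1..k}" "i' \<in> {1..k}" "i \<noteq> i'"
    hence "i - 1 \<noteq> i' - 1" by auto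
    thus "?a i ` {1..k} \<inter> ?a i' ` {1..k} = {}" using i k by (auto simp: a_eq)
  qed
  moreover have "disjoint_family_on (\<lambda>j. ?c j ` {1..k}) {1..k}"
    unfolding disjoint_family_on_def
  proof (intro ballI impI)
    fix i i' assume i: "i \<in> {1..k}" "i' \<in> {1..k}" "i \<noteq> i'"
    hence "i - 1 \<noteq> i' - 1" by auto
    thus "?c i ` {1..k} \<inter> ?c i' ` {1..k} = {}" using i k by (auto simp: c_eq)
  qed
  moreover have "\<forall>i\<in>{1..k}. \<forall>j\<in>{1..k}. ?b i j \<in> B \<and>
      (\<forall>l\<in>{1..k}. (?a i l, ?b i j, ?c j (k - l + 1)) \<in> collinear_triples A B C)"
  proof (intro ballI conjI)
    fix i j assume ij: "i \<in> {1..k}" "j \<in> {1..k}"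
    thus "?b i j \<in> B" using k b by auto
    fix l assume l: "l \<in> {1..k}"
    hence "k - (k - l + 1) = l - 1" by auto
    thus "(?a i l, ?b i j, ?c j (k - l + 1)) \<in> collinear_triples A B C"
      using ij l k tri by auto
  qed
  ultimately show ?thesis unfolding has_k_system_def
    by (intro exI[of _ ?a] exI[of _ ?b] exI[of _ ?c] conjI)
qed

section \<open>Monotone matchings from collinear triples\<close>

context avoiding_sets
begin

definition sight_matching :: "(nat \<Rightarrow> real^2) \<Rightarrow> (nat \<Rightarrow> real^2) \<Rightarrow> nat \<Rightarrow> real^2 \<Rightarrow> (nat \<times> nat) set" where
  "sight_matching \<alpha> \<beta> n b =
    {p \<in> {..<n} \<times> {..<n}. (\<alpha> (fst p), b, \<beta> (snd p)) \<in> collinear_triples A B C}"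

text \<open>By \<open>triple_pair_sign\<close>, \<open>h\<close> has one strict sign on the whole
  matching once there are two pairs: positive \<open>h\<close> reverses the order, negative
  \<open>h\<close> preserves it.\<close>

lemma monotone_sight_matching:
  assumes inj: "inj_on \<alpha> {..<n}" "inj_on \<beta> {..<n}"
    and \<alpha>: "\<And>i j. i < n \<Longrightarrow> j < n \<Longrightarrow> f (\<alpha> i) < f (\<alpha> j) \<longleftrightarrow> i < j"
    and \<beta>: "\<And>i j. i < n \<Longrightarrow> j < n \<Longrightarrow> g (\<beta> i) < g (\<beta> j) \<longleftrightarrow> i < j"
  shows "monotone_matching (sight_matching \<alpha> \<beta> n b)"
proof -
  let ?M = "sight_matching \<alpha> \<beta> n b"
  define h where "h p = (\<alpha> (fst p) - b) \<bullet> (\<beta> (snd p) - b)" for p :: "nat \<times> nat"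
  have lt: "fst p < n" "snd p < n" if "p \<in> ?M" for p using that by (auto simp: sight_matching_def)
  have tri: "(\<alpha> (fst p), b, \<beta> (snd p)) \<in> collinear_triples A B C" if "p \<in> ?M" for p
    using that by (auto simp: sight_matching_def)
  have eq: "fst p = fst q \<longleftrightarrow> snd p = snd q" if "p \<in> ?M" "q \<in> ?M" for p q
    using triple_eq_iff[OF tri tri, OF that] lt that inj by (simp add: inj_on_eq_iff)
  have sign: "(f (\<alpha> (fst q)) - f (\<alpha> (fst p))) * (g (\<beta> (snd q)) - g (\<beta> (snd p))) * h p < 0"
    "0 < h p * h q" if "p \<in> ?M" "q \<in> ?M" "fst p \<noteq> fst q" for p q
  proof -
    have "\<alpha> (fst p) \<noteq> \<alpha> (fst q)" using that lt inj by (simp add: inj_on_eq_iff)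
    from triple_pair_sign[OF tri tri this, OF that(1,2)]
    show "(f (\<alpha> (fst q)) - f (\<alpha> (fst p))) * (g (\<beta> (snd q)) - g (\<beta> (snd p))) * h p < 0"
      "0 < h p * h q" by (simp_all add: h_def)
  qed
  have less: "fst p < fst q \<longleftrightarrow> 0 < f (\<alpha> (fst q)) - f (\<alpha> (fst p))"
    "snd p < snd q \<longleftrightarrow> 0 < g (\<beta> (snd q)) - g (\<beta> (snd p))"
    "snd q < snd p \<longleftrightarrow> g (\<beta> (snd q)) - g (\<beta> (snd p)) < 0"
    if "p \<in> ?M" "q \<in> ?M" for p q
    using lt that \<alpha>[of "fst p" "fst q"] \<beta>[of "snd p" "snd q"] \<beta>[of "snd q" "snd p"] by auto
  show ?thesis
  proof (cases "\<forall>p\<in>?M. 0 < h p")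
    case True
    have "fst p < fst q \<longleftrightarrow> snd q < snd p" if pq: "p \<in> ?M" "q \<in> ?M" for p q
    proof (cases "fst p = fst q")
      case False
      have "0 < h p" using True pq by blast
      moreover have "(f (\<alpha> (fst q)) - f (\<alpha> (fst p))) * (g (\<beta> (snd q)) - g (\<beta> (snd p))) * h p < 0 * h p"
        using sign(1)[OF pq False] by simp
      ultimately have "(f (\<alpha> (fst q)) - f (\<alpha> (fst p))) * (g (\<beta> (snd q)) - g (\<beta> (snd p))) < 0"
        by (simp only: mult_less_cancel_right_pos)
      thus ?thesis unfolding less[OF pq] by (auto simp: mult_less_0_iff)
    qed (use eq[OF pq] in auto)
    thus ?thesis by (simp add: monotone_matching_def anti_matching_def)
  next
    case False
    then obtain p0 where p0: "p0 \<in> ?M" "h p0 \<le> 0" by force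
    have "fst p < fst q \<longleftrightarrow> snd p < snd q" if pq: "p \<in> ?M" "q \<in> ?M" for p q
    proof (cases "fst p = fst q")
      case False
      \<comment> \<open>Either \<open>p\<close> is \<open>p0\<close>, where \<open>h\<close> is
        nonzero because of the other pair \<open>q\<close>, or \<open>h p\<close> and
        \<open>h p0\<close> have the same strict sign.\<close>
      have "h p < 0"
      proof (cases "fst p = fst p0")
        case True
        hence "p = p0" using eq[OF pq(1) p0(1)] by (simp add: prod_eq_iff)
        thus ?thesis using sign(1)[OF pq False] p0 by (cases "h p = 0") auto
      next
        case False
        thus ?thesis using sign(2)[OF pq(1) p0(1) False] p0 by (auto simp: zero_less_mult_iff)
      qed
      moreover have "(f (\<alpha> (fst q)) - f (\<alpha> (fst p))) * (g (\<beta> (snd q)) - g (\<beta> (snd p))) * h p < 0 * h p"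
        using sign(1)[OF pq False] by simp
      ultimately have "0 < (f (\<alpha> (fst q)) - f (\<alpha> (fst p))) * (g (\<beta> (snd q)) - g (\<beta> (snd p)))"
        by (simp only: mult_less_cancel_right_neg)
      thus ?thesis unfolding less[OF pq] by (auto simp: zero_less_mult_iff)
    qed (use eq[OF pq] in auto)
    thus ?thesis by (simp add: monotone_matching_def iso_matching_def)
  qed
qed

text \<open>Numbering \<open>A\<close> and \<open>C\<close> along their keys turns the triples
  through \<open>b\<close> into a monotone matching of indices, and the grid found among these
  matchings is mapped back to points.\<close>

lemma has_k_system_if_many_triples:
  assumes fin: "finite A" "finite B" "finite C" and card: "card A = n" "card B = n" "card C = n"
    and K: "2 \<le> K" "k \<le> K" and t: "(4 * K) ^ (K + 1) < t"
    and n: "t ^ ((2 * K + 1) * (K + 1) + 1) \<le> n"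
    and many: "8 * K * n\<^sup>2 \<le> t * card (collinear_triples A B C)"
  shows "has_k_system k A B C"
proof -
  obtain \<alpha> where \<alpha>: "bij_betw \<alpha> {..<n} A"
    "\<And>i j. i < n \<Longrightarrow> j < n \<Longrightarrow> f (\<alpha> i) < f (\<alpha> j) \<longleftrightarrow> i < j"
    using sorted_enumeration[OF fin(1) inj_key(1)] card by metis
  obtain \<beta> where \<beta>: "bij_betw \<beta> {..<n} C"
    "\<And>i j. i < n \<Longrightarrow> j < n \<Longrightarrow> g (\<beta> i) < g (\<beta> j) \<longleftrightarrow> i < j"
    using sorted_enumeration[OF fin(3) inj_key(2)] card by metis
  have inj: "inj_on \<alpha> {..<n}" "inj_on \<beta> {..<n}"
    using \<alpha> \<beta> by (simp_all add: bij_betw_def)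
  define M where "M = sight_matching \<alpha> \<beta> n"
  have Msub: "M b \<subseteq> {..<n} \<times> {..<n}" for b by (auto simp: M_def sight_matching_def)
  hence finM: "finite (M b)" for b by (rule finite_subset) simp
  have "collinear_triples A B C \<subseteq> (\<lambda>(b, i, j). (\<alpha> i, b, \<beta> j)) ` Sigma B M"
  proof clarify
    fix a b c assume abc: "(a, b, c) \<in> collinear_triples A B C"
    hence "a \<in> A" "b \<in> B" "c \<in> C" by (auto simp: collinear_triples_def)
    then obtain i j where "i < n" "j < n" "a = \<alpha> i" "c = \<beta> j"
      using \<alpha>(1) \<beta>(1) by (auto simp: bij_betw_def)
    thus "(a, b, c) \<in> (\<lambda>(b, i, j). (\<alpha> i, b, \<beta> j)) ` Sigma B M"
      using abc \<open>b \<in> B\<close> by (intro image_eqI[of _ _ "(b, i, j)"]) (auto simp: M_def sight_matching_def)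
  qed
  hence "card (collinear_triples A B C) \<le> card (Sigma B M)"
    using fin finM by (intro surj_card_le) auto
  also have "\<dots> = (\<Sum>b\<in>B. card (M b))" using fin finM by simp
  finally have "t * card (collinear_triples A B C) \<le> t * (\<Sum>b\<in>B. card (M b))" by simp
  with many have large: "8 * K * n\<^sup>2 \<le> t * (\<Sum>b\<in>B. card (M b))" by linarith
  have unique: "b = b'"
    if "p \<in> M b" "p \<in> M b'" "q \<in> M b" "q \<in> M b'" "fst p \<noteq> fst q" for b b' p q
  proof -
    have "\<alpha> (fst p) \<noteq> \<alpha> (fst q)"
      using that inj by (auto simp: M_def sight_matching_def inj_on_eq_iff)
    with that show ?thesis
      by (intro triples_through_same_point[of "\<alpha> (fst p)" b "\<beta> (snd p)" "\<alpha> (fst q)" "\<beta> (snd q)"])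
        (simp_all add: M_def sight_matching_def)
  qed
  have mono: "monotone_matching (M b)" for b
    unfolding M_def by (rule monotone_sight_matching[OF inj \<alpha>(2) \<beta>(2)])
  obtain u v w where
    u: "inj_on (\<lambda>(i, l). u i l) ({..<K} \<times> {..<K})" and w: "inj_on (\<lambda>(j, l). w j l) ({..<K} \<times> {..<K})"
    and v: "\<And>i j. i < K \<Longrightarrow> j < K \<Longrightarrow> v i j \<in> B"
    and uvw: "\<And>i j l. i < K \<Longrightarrow> j < K \<Longrightarrow> l < K \<Longrightarrow> (u i l, w j l) \<in> M (v i j)"
    by (rule matchings_contain_grid[OF fin(2) eq_refl[OF card(2)] Msub mono unique K(1) t n large]) blast+
  have lt: "u i l < n" "w i l < n" if "i < K" "l < K" for i l
    using uvw[of i i l] that by (auto simp: M_def sight_matching_def)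
  show ?thesis
  proof (rule has_k_systemI[where a = "\<lambda>i l. \<alpha> (u i l)" and c = "\<lambda>j l. \<beta> (w j l)" and b = v, OF _ _ K(2)])
    show "inj_on (\<lambda>(i, l). \<alpha> (u i l)) ({..<K} \<times> {..<K})"
      using comp_inj_on[OF u inj_on_subset[OF inj(1)]] lt by (simp add: comp_def case_prod_unfold image_subset_iff)
    show "inj_on (\<lambda>(j, l). \<beta> (w j l)) ({..<K} \<times> {..<K})"
      using comp_inj_on[OF w inj_on_subset[OF inj(2)]] lt by (simp add: comp_def case_prod_unfold image_subset_iff)
    show "v i j \<in> B" if "i < K" "j < K" for i j using v that .
    show "(\<alpha> (u i l), v i j, \<beta> (w j l)) \<in> collinear_triples A B C" if "i < K" "j < K" "l < K" for i j l
      using uvw[OF that] by (simp add: M_def sight_matching_def)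
  qed
qed

end

section \<open>Choice of the constants\<close>

theorem theorem3p2:
  fixes k :: nat
  shows "\<exists>(\<gamma>::real) (\<mu>::real) (n0::nat). \<gamma> > 0 \<and> \<mu> > 0 \<and>
    (\<forall>(n::nat) (A::(real^2) set) (B::(real^2) set) (C::(real^2) set).
       n \<ge> n0 \<longrightarrow>
       finite A \<and> card A = n \<longrightarrow> finite B \<and> card B = n \<longrightarrow> finite C \<and> card C = n \<longrightarrow>
       mutually_avoiding A C \<longrightarrow>
       line_avoiding A B \<longrightarrow> line_avoiding C B \<longrightarrow>
       real (card (collinear_triples A B C)) \<ge> \<mu> * real n powr (2 - \<gamma>) \<longrightarrow>
       has_k_system k A B C)"
proof -
  \<comment> \<open>A cell needs two positions to determine \<open>b\<close>; taking the maximum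
    also covers \<open>k < 2\<close>.\<close>
  define K where "K = max k 2"
  have K: "2 \<le> K" "k \<le> K" by (simp_all add: K_def)
  \<comment> \<open>\<open>q\<close> is the exponent required by
    \<open>matchings_contain_grid\<close> and \<open>s\<close> the least admissible
    \<open>t\<close>; so \<open>\<gamma> = 1 / q\<close>, and \<open>n \<ge> s ^ q\<close> makes the
    \<open>q\<close>-th root of \<open>n\<close> at least \<open>s\<close>.\<close>
  define q where "q = (2 * K + 1) * (K + 1) + 1"
  define s where "s = (4 * K) ^ (K + 1) + 1"
  have q: "0 < q" by (simp add: q_def)
  have s2: "2 \<le> s" using K by (simp add: s_def Suc_le_eq)
  have "has_k_system k A B C"
    if n: "s ^ q \<le> n" and A: "finite A" "card A = n" and B: "finite B" "card B = n"
      and C: "finite C" "card C = n" and AC: "mutually_avoiding A C"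
      and AB: "line_avoiding A B" and CB: "line_avoiding C B"
      and many: "16 * real K * real n powr (2 - 1 / real q) \<le> real (card (collinear_triples A B C))"
    for n and A B C :: "(real^2) set"
  proof -
    have "s \<le> s ^ q" using s2 q by (intro self_le_power) auto
    hence n2: "2 \<le> n" using s2 n by linarith
    define r where "r = real n powr (1 / real q)"
    have r0: "0 < r" using n2 by (simp add: r_def)
    have rq: "r ^ q = real n"
      using n2 q by (simp add: r_def powr_powr flip: powr_realpow)
    have "real s ^ q \<le> r ^ q" using n by (simp add: rq flip: of_nat_power)
    hence sr: "real s \<le> r" using r0 q by (simp add: power_mono_iff)
    define t where "t = nat \<lfloor>r\<rfloor>"
    have t: "real t \<le> r" "r < real t + 1" using r0 by (simp_all add: t_def)
    have st: "s \<le> t" using sr by (simp add: t_def le_nat_floor)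
    have "real (t ^ q) \<le> r ^ q" using t by (simp add: power_mono)
    hence tq: "t ^ q \<le> n" unfolding rq by linarith
    have "r \<le> 2 * real t" using t st s2 by linarith
    have pw: "real n powr (2 - 1 / real q) = (real n)\<^sup>2 / r"
      using n2 by (simp add: r_def powr_diff powr_numeral)
    \<comment> \<open>The constant 16 is twice the required 8, because rounding \<open>r\<close>
      down to \<open>t\<close> may lose a factor 2.\<close>
    have "8 * real K * (real n)\<^sup>2 = (r / 2) * (16 * real K * ((real n)\<^sup>2 / r))"
      using r0 by simp
    also have "\<dots> \<le> real t * real (card (collinear_triples A B C))"
      using many \<open>r \<le> 2 * real t\<close> r0 by (intro mult_mono) (simp_all add: pw)
    finally have "real (8 * K * n\<^sup>2) \<le> real (t * card (collinear_triples A B C))" by simp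
    hence large: "8 * K * n\<^sup>2 \<le> t * card (collinear_triples A B C)" by linarith
    have two: "\<exists>p\<in>X. \<exists>q\<in>X. p \<noteq> q" if "card X = n" for X :: "(real^2) set"
      using that n2 card_le_Suc0_iff_eq[of X] card.infinite[of X] by fastforce
    have av: "line_avoiding A C" "line_avoiding C A" using AC by (simp_all add: mutually_avoiding_def)
    obtain a0 a1 where a: "a0 \<in> A" "a1 \<in> A" "a0 \<noteq> a1" using two[OF A(2)] by blast
    obtain c0 c1 where c: "c0 \<in> C" "c1 \<in> C" "c0 \<noteq> c1" using two[OF C(2)] by blast
    obtain f :: "real^2 \<Rightarrow> real" where
      f: "\<And>p q y. \<lbrakk>p \<in> A; q \<in> A; p \<noteq> q; y \<in> C\<rbrakk> \<Longrightarrow> 0 < (f q - f p) * det2 (q - p) (y - p)"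
      using sight_order_key[OF av c] by blast
    obtain g :: "real^2 \<Rightarrow> real" where
      g: "\<And>p q y. \<lbrakk>p \<in> C; q \<in> C; p \<noteq> q; y \<in> A\<rbrakk> \<Longrightarrow> 0 < (g q - g p) * det2 (q - p) (y - p)"
      using sight_order_key[OF av(2,1) a] by blast
    interpret avoiding_sets A B C f g
    proof (rule avoiding_sets.intro)
      show "0 < (f q - f p) * det2 (q - p) (y - p)" if "p \<in> A" "q \<in> A" "p \<noteq> q" "y \<in> C" for p q y
        using that by (rule f)
      show "0 < (g q - g p) * det2 (q - p) (y - p)" if "p \<in> C" "q \<in> C" "p \<noteq> q" "y \<in> A" for p q y
        using that by (rule g)
    qed (fact av AB CB two[OF A(2)] two[OF C(2)])+
    show ?thesis
      by (rule has_k_system_if_many_triples[OF A(1) B(1) C(1) A(2) B(2) C(2) K _ _ large])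
        (use st tq in \<open>simp_all add: s_def q_def\<close>)
  qed
  thus ?thesis
    using q K by (intro exI[of _ "1 / real q"] exI[of _ "16 * real K"] exI[of _ "s ^ q"]) auto
qed

end
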